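(* Let $d,D,n\ge 1$ be integers, let $L_{\mathcal H}>0$, and let $X_1,\ldots,X_n\in[0,1]^D$. Let $g:[0,1]^d\to[0,1]^D$ have an $L_{\mathcal H}$-Lipschitz-continuous left inverse, that is, there exists an $L_{\mathcal H}$-Lipschitz-continuous function $h:\mathbb R^D\to\mathbb R^d$ such that $h(g(u))=u$ for all $u\in[0,1]^d$. Then for every probability measure $Q$ satisfying $Q(\{X_1,\ldots,X_n\})=1$, $$\mathsf W_1(g\sharp\,\mathcal U_d,\,Q)\;\ge\;\frac{1}{2L_{\mathcal H}\bigl(1+(2\mathsf V_d\,n)^{1/d}\bigr)}.$$
   Context: $\|\cdot\|$ is the Euclidean norm. A function $f:A\to B$ between subsets of Euclidean spaces is $L$-Lipschitz-continuous if $\|f(x)-f(x')\|\le L\|x-x'\|$ for all $x,x'\in A$. $\mathcal U_d$ is the uniform distribution on $[0,1]^d$. For a (Borel measurable) map $g:[0,1]^d\to\mathbb R^D$, $g\sharp\,\mathcal U_d$ is the push-forward of $\mathcal U_d$ by $g$, i.e. $(g\sharp\,\mathcal U_d)(A)=\mathcal U_d(g^{-1}(A))$ for Borel $A\subseteq\mathbb R^D$. $\mathsf W_1$ is the Wasserstein-1 distance, $\mathsf W_1(P,Q)=\sup_f|\mathbb E_P[f(X)]-\mathbb E_Q[f(X)]|$, the supremum being over all 1-Lipschitz-continuous $f:\mathbb R^D\to\mathbb R$. $\mathsf V_d=\pi^{d/2}/\Gamma(1+d/2)$ is the volume of the unit ball of $\mathbb R^d$. *)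

theory Defs
  imports "HOL-Probability.Probability"
begin

abbreviation unit_cube :: "(real ^ 'n) set" where
  "unit_cube \<equiv> cbox 0 1"

(* The underlying space is the cube itself rather than the ambient space, so that a map out of
   this measure only has to be measurable on the cube. *)
definition uniform_cube :: "(real ^ 'n) measure" where
  "uniform_cube = uniform_measure (restrict_space lborel unit_cube) unit_cube"

(* The supremum is taken in the extended nonnegative reals, so it is infinite when unbounded.
   The Bochner integral of a non-integrable function is 0, so the definition is meaningful for
   probability measures with finite first moments. *)
definition wasserstein1 :: "'a::metric_space measure \<Rightarrow> 'a measure \<Rightarrow> ennreal" where
  "wasserstein1 P Q =
     (SUP f \<in> {f :: 'a \<Rightarrow> real. 1-lipschitz_on UNIV f}.
        ennreal \<bar>(\<integral>x. f x \<partial>P) - (\<integral>x. f x \<partial>Q)\<bar>)"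

end

theory Submission
  imports Defs
begin

text \<open>
  The Wasserstein distance is bounded below by testing against the distance to the finite set
  \<open>S = {X\<^sub>1, \<dots>, X\<^sub>n}\<close> that carries \<open>Q\<close>: this function is 1-Lipschitz and vanishes \<open>Q\<close>-almost
  surely, so what remains is the mean distance of \<open>g u\<close> to \<open>S\<close> for uniform \<open>u\<close>
  (\<open>wasserstein1_ge_integral_infdist\<close>).

  Since \<open>h\<close> expands distances by at most \<open>L\<close> and undoes \<open>g\<close>, a point \<open>u\<close> at distance at least
  \<open>r\<close> from every \<open>h X\<^sub>i\<close> has an image at distance at least \<open>r / L\<close> from \<open>S\<close>
  (\<open>infdist_image_ge_of_lipschitz_left_inverse\<close>). The excluded \<open>n\<close> balls of radius \<open>r\<close> have total
  volume at most \<open>n V\<^sub>d r\<^sup>d\<close>, which is \<open>1/2\<close> for \<open>r = (2 V\<^sub>d n) powr (- 1 / d)\<close>. Hence at least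
  half of the cube lies outside them (\<open>measure_uniform_cube_Diff_balls_ge\<close>), and the mean distance
  is at least \<open>r / (2 L) = 1 / (2 L (2 V\<^sub>d n) powr (1 / d))\<close>, which exceeds the claimed bound.
\<close>

lemma emeasure_lborel_unit_cube: "emeasure lborel (unit_cube :: (real ^ 'n) set) = 1"
proof -
  have "measure lborel (cbox 0 1 :: (real ^ 'n) set) = 1"
    by (subst content_cbox_cart) (auto simp: interval_ne_empty_cart)
  then show ?thesis
    using emeasure_lborel_cbox_finite[of "0 :: real ^ 'n" 1]
    by (subst emeasure_eq_ennreal_measure) auto
qed

lemma sets_uniform_cube:
  "sets (uniform_cube :: (real ^ 'n) measure) = sets (restrict_space borel unit_cube)"
  by (simp add: uniform_cube_def cong: sets_restrict_space_cong)

lemma space_uniform_cube: "space uniform_cube = unit_cube"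
  by (simp add: uniform_cube_def space_restrict_space)

lemma emeasure_uniform_cube:
  fixes A :: "(real ^ 'n) set"
  assumes "A \<in> sets borel" "A \<subseteq> unit_cube"
  shows "emeasure uniform_cube A = emeasure lborel A"
proof -
  have "A \<in> sets (restrict_space lborel unit_cube)"
       "unit_cube \<in> sets (restrict_space lborel (unit_cube :: (real ^ 'n) set))"
    using assms by (auto simp: sets_restrict_space_iff)
  moreover have "unit_cube \<inter> A = A" using assms by auto
  ultimately show ?thesis
    using assms
    by (simp add: uniform_cube_def emeasure_restrict_space emeasure_lborel_unit_cube divide_ennreal_def)
qed

lemma prob_space_uniform_cube: "prob_space (uniform_cube :: (real ^ 'n) measure)"
  by (rule prob_spaceI)
     (simp add: space_uniform_cube emeasure_uniform_cube emeasure_lborel_unit_cube)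

text \<open>
  Union bound. Each ball takes at most its own Lebesgue volume from the cube, whether or not its
  centre lies in the cube; this matters because \<open>h\<close> may map the points \<open>X\<^sub>i\<close> outside the cube.
\<close>

lemma measure_uniform_cube_Diff_balls_ge:
  fixes c :: "'i \<Rightarrow> real ^ 'n"
  assumes "finite I" "r \<ge> 0"
  shows "measure uniform_cube (unit_cube - (\<Union>i\<in>I. ball (c i) r))
           \<ge> 1 - real (card I) * (unit_ball_vol (real CARD('n)) * r ^ CARD('n))"
proof -
  interpret prob_space "uniform_cube :: (real ^ 'n) measure"
    by (rule prob_space_uniform_cube)
  let ?V = "unit_ball_vol (real CARD('n)) * r ^ CARD('n)"
  have V: "0 \<le> ?V" using assms by simp
  have ball: "measure uniform_cube (unit_cube \<inter> ball (c i) r) \<le> ?V" for i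
  proof -
    have "emeasure uniform_cube (unit_cube \<inter> ball (c i) r) \<le> emeasure lborel (ball (c i) r)"
      by (subst emeasure_uniform_cube) (auto intro!: emeasure_mono)
    also have "\<dots> = ennreal ?V"
      using assms by (simp add: emeasure_ball)
    finally show ?thesis
      using V by (simp add: emeasure_eq_measure)
  qed
  have sets: "unit_cube \<inter> ball (c i) r \<in> events" for i
    by (auto simp: sets_uniform_cube sets_restrict_space_iff)
  have "measure uniform_cube (\<Union>i\<in>I. unit_cube \<inter> ball (c i) r)
          \<le> (\<Sum>i\<in>I. measure uniform_cube (unit_cube \<inter> ball (c i) r))"
    using assms sets by (intro finite_measure_subadditive_finite) auto
  also have "\<dots> \<le> real (card I) * ?V"
    using ball by (intro sum_bounded_above) auto
  finally have "measure uniform_cube (\<Union>i\<in>I. unit_cube \<inter> ball (c i) r) \<le> real (card I) * ?V" .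
  moreover have "unit_cube - (\<Union>i\<in>I. ball (c i) r)
      = space uniform_cube - (\<Union>i\<in>I. unit_cube \<inter> ball (c i) r)"
    by (auto simp: space_uniform_cube)
  moreover have "(\<Union>i\<in>I. unit_cube \<inter> ball (c i) r) \<in> events"
    using assms(1) sets by (rule sets.finite_UN)
  ultimately show ?thesis
    by (simp add: prob_compl)
qed

lemma lipschitz_on_infdist: "1-lipschitz_on UNIV (\<lambda>x. infdist x S)"
proof (rule lipschitz_onI)
  fix x y
  show "dist (infdist x S) (infdist y S) \<le> 1 * dist x y"
    using infdist_triangle[of x S y] infdist_triangle[of y S x]
    by (simp add: dist_real_def dist_commute)
qed simp

text \<open>
  The distance to \<open>S\<close> is the largest 1-Lipschitz function vanishing on \<open>S\<close>, hence the best test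
  function among those whose \<open>Q\<close>-integral vanishes because they are \<open>0\<close> on \<open>S\<close>.
\<close>

lemma wasserstein1_ge_integral_infdist:
  fixes Q :: "'a::metric_space measure"
  assumes "prob_space Q" "measure Q S = 1"
  shows "wasserstein1 P Q \<ge> ennreal (\<integral>x. infdist x S \<partial>P)"
proof -
  interpret prob_space Q by fact
  have "AE x in Q. x \<in> S" using assms(2) by (rule AE_prob_1)
  then have "AE x in Q. infdist x S = 0" by eventually_elim simp
  then have "(\<integral>x. infdist x S \<partial>Q) = 0"
    by (rule integral_eq_zero_AE)
  moreover have "0 \<le> (\<integral>x. infdist x S \<partial>P)"
    by (simp add: infdist_nonneg)
  ultimately have "ennreal (\<integral>x. infdist x S \<partial>P)
      = ennreal \<bar>(\<integral>x. infdist x S \<partial>P) - (\<integral>x. infdist x S \<partial>Q)\<bar>"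
    by simp
  also have "\<dots> \<le> wasserstein1 P Q"
    unfolding wasserstein1_def by (rule SUP_upper) (simp add: lipschitz_on_infdist)
  finally show ?thesis .
qed

text \<open>
  An \<open>L\<close>-Lipschitz left inverse prevents \<open>g\<close> from contracting distances by more than the factor
  \<open>L\<close>, even between \<open>g u\<close> and points \<open>x\<close> outside the range of \<open>g\<close>: there \<open>h x\<close> takes the role
  of a preimage of \<open>x\<close>.
\<close>

lemma infdist_image_ge_of_lipschitz_left_inverse:
  fixes h :: "'a::metric_space \<Rightarrow> 'b::metric_space"
  assumes "L-lipschitz_on UNIV h" "L > 0" "h (g u) = u" "S \<noteq> {}"
    and far: "\<And>x. x \<in> S \<Longrightarrow> r \<le> dist (h x) u"
  shows "r / L \<le> infdist (g u) S"
  unfolding infdist_notempty[OF \<open>S \<noteq> {}\<close>]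
proof (rule cINF_greatest[OF \<open>S \<noteq> {}\<close>])
  fix x assume "x \<in> S"
  have "r \<le> dist (h (g u)) (h x)"
    using far[OF \<open>x \<in> S\<close>] assms by (simp add: dist_commute)
  also have "\<dots> \<le> L * dist (g u) x"
    using assms(1) by (rule lipschitz_onD) auto
  finally show "r / L \<le> dist (g u) x"
    using \<open>L > 0\<close> by (simp add: field_simps)
qed

theorem proposition1:
  fixes n :: nat and L :: real
    and X :: "nat \<Rightarrow> real ^ 'D"
    and g :: "real ^ 'd \<Rightarrow> real ^ 'D"
    and Q :: "(real ^ 'D) measure"
  assumes "n \<ge> 1" and "L > 0"
    and "\<And>i. i \<in> {1..n} \<Longrightarrow> X i \<in> unit_cube"
    and "g \<in> unit_cube \<rightarrow> unit_cube"
    and "g \<in> borel_measurable (restrict_space borel unit_cube)"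
    and "\<exists>h :: real ^ 'D \<Rightarrow> real ^ 'd. L-lipschitz_on UNIV h \<and> (\<forall>u \<in> unit_cube. h (g u) = u)"
    and "prob_space Q" and "sets Q = sets borel"
    and "measure Q (X ` {1..n}) = 1"
  shows "wasserstein1 (distr uniform_cube borel g) Q
    \<ge> ennreal (1 / (2 * L * (1 + (2 * unit_ball_vol (real CARD('d)) * real n)
                                    powr (1 / real CARD('d)))))"
proof -
  define S where "S = X ` {1..n}"
  define B where "B = 2 * unit_ball_vol (real CARD('d)) * real n"
  define r where "r = 1 / B powr (1 / real CARD('d))"
  obtain h :: "real ^ 'D \<Rightarrow> real ^ 'd"
    where h: "L-lipschitz_on UNIV h" "\<And>u. u \<in> unit_cube \<Longrightarrow> h (g u) = u"
    using assms(6) by blast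
  have S: "S \<noteq> {}" using \<open>n \<ge> 1\<close> by (auto simp: S_def)
  have vol: "unit_ball_vol (real CARD('d)) > 0" by simp
  then have "B > 0" using \<open>n \<ge> 1\<close> by (simp add: B_def)
  then have "r > 0" by (simp add: r_def)
  have "(B powr (1 / real CARD('d))) ^ CARD('d) = B"
    using \<open>B > 0\<close> by (simp add: powr_powr flip: powr_realpow)
  then have r_power: "r ^ CARD('d) = 1 / B"
    by (simp add: r_def power_divide)
  interpret U: prob_space "uniform_cube :: (real ^ 'd) measure"
    by (rule prob_space_uniform_cube)
  have g_meas [measurable]: "g \<in> borel_measurable uniform_cube"
    using assms(5) by (simp add: sets_uniform_cube cong: measurable_cong_sets)
  have [measurable]: "(\<lambda>x. infdist x S) \<in> borel_measurable borel"
    by (intro borel_measurable_continuous_onI continuous_intros)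
  define A where "A = unit_cube - (\<Union>i\<in>{1..n}. ball (h (X i)) r)"
  have A_sets: "A \<in> sets uniform_cube"
    unfolding A_def sets_uniform_cube by (auto simp: sets_restrict_space_iff)
  have half: "1 / 2 \<le> measure uniform_cube A"
  proof -
    have "real n * (unit_ball_vol (real CARD('d)) * r ^ CARD('d)) = 1 / 2"
      using \<open>n \<ge> 1\<close> less_imp_neq[OF vol] unfolding r_power by (simp add: B_def)
    then show ?thesis
      using measure_uniform_cube_Diff_balls_ge[of "{1..n}" r "\<lambda>i. h (X i)"] \<open>r > 0\<close>
      by (simp add: A_def)
  qed
  have far: "r / L \<le> infdist (g u) S" if "u \<in> A" for u
    by (rule infdist_image_ge_of_lipschitz_left_inverse[OF h(1) \<open>L > 0\<close> h(2) S])
       (use that in \<open>auto simp: A_def S_def\<close>)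
  have integrable: "integrable uniform_cube (\<lambda>u. infdist (g u) S)"
  proof -
    have "bounded ((\<lambda>x. infdist x S) ` (unit_cube :: (real ^ 'D) set))"
      by (intro compact_imp_bounded compact_continuous_image continuous_intros) auto
    then obtain C where C: "\<And>x. x \<in> unit_cube \<Longrightarrow> norm (infdist x S) \<le> C"
      by (auto simp: bounded_iff)
    show ?thesis
    proof (rule U.integrable_const_bound[of _ C])
      show "AE u in uniform_cube. norm (infdist (g u) S) \<le> C"
        using C assms(4) by (intro AE_I2) (simp add: space_uniform_cube Pi_iff)
      show "(\<lambda>u. infdist (g u) S) \<in> borel_measurable uniform_cube"
        by measurable
    qed
  qed
  \<comment> \<open>Markov's inequality: the distance is at least \<open>r / L\<close> on the set \<open>A\<close> of measure at least \<open>1/2\<close>.\<close>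
  have "1 / (2 * L * (1 + B powr (1 / real CARD('d)))) \<le> r / L * (1 / 2)"
    using \<open>L > 0\<close> \<open>B > 0\<close>
    by (simp add: r_def mult.assoc) (intro divide_left_mono mult_pos_pos; simp add: add_pos_pos)
  also have "\<dots> \<le> r / L * measure uniform_cube A"
    using half \<open>r > 0\<close> \<open>L > 0\<close> by (intro mult_left_mono) auto
  also have "\<dots> = (\<integral>u. r / L * indicator A u \<partial>uniform_cube)"
    using A_sets by simp
  also have "\<dots> \<le> (\<integral>u. infdist (g u) S \<partial>uniform_cube)"
  proof (rule integral_mono)
    show "integrable uniform_cube (\<lambda>u. r / L * indicator A u)"
      using A_sets by (intro integrable_mult_right integrable_real_indicator)
        (auto simp: less_top[symmetric])
    show "r / L * indicator A u \<le> infdist (g u) S" for u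
      using far by (auto simp: indicator_def infdist_nonneg)
  qed (rule integrable)
  also have "\<dots> = (\<integral>x. infdist x S \<partial>distr uniform_cube borel g)"
    by (subst integral_distr) auto
  finally have "ennreal (1 / (2 * L * (1 + B powr (1 / real CARD('d)))))
      \<le> ennreal (\<integral>x. infdist x S \<partial>distr uniform_cube borel g)"
    by (rule ennreal_leI)
  also have "\<dots> \<le> wasserstein1 (distr uniform_cube borel g) Q"
    using assms(7,9) unfolding S_def by (rule wasserstein1_ge_integral_infdist)
  finally show ?thesis by (simp add: B_def)
qed

end
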